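(* Let $G_1$ be an $r_1$-regular graph on $n_1$ vertices and $G_2$ an arbitrary graph on $n_2$ vertices, where $n_1 \geq 2$, $n_2 \geq 1$ and $r_1 \geq 1$, and let $\mu_1(G_1)\le\dots\le\mu_{n_1}(G_1)$ be the eigenvalues of $L(G_1)$. Then $$\phi(L(G_1 \star G_2); x) = (\phi(L(G_2); x - r_1))^{n_1} \cdot \prod_{i=1}^{n_1} \left(x - n_2 r_1 - \mu_i(G_1) - \Gamma_{L(G_2)}(x - r_1)\,(r_1 - \mu_i(G_1))^2\right).$$
   Context: All graphs are finite, undirected and simple. For a graph $G$, $A(G)$ is its adjacency matrix, $D(G)$ the diagonal matrix of degrees, and $L(G)=D(G)-A(G)$ its Laplacian matrix. For a square matrix $M$ of order $n$, $\phi(M;x)=\det(xI_n-M)$, and the $M$-coronal is the rational function $\Gamma_M(x)=\mathbf{1}_n^T(xI_n-M)^{-1}\mathbf{1}_n$ with $\mathbf{1}_n$ the all-ones column vector. The neighbourhood corona $G_1\star G_2$ of graphs $G_1$ (with vertices $v_1,\dots,v_{n_1}$) and $G_2$ is the graph obtained by taking one copy of $G_1$ and $n_1$ copies of $G_2$, all vertex-disjoint, and joining every neighbour (in $G_1$) of $v_i$ to every vertex of the $i$th copy of $G_2$ by a new edge, for each $i$. The identity is one of rational functions in $x$. *)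

theory Defs
  imports
    "HOL-Computational_Algebra.Polynomial_Factorial"
    "Jordan_Normal_Form.Char_Poly"
    "Jordan_Normal_Form.Gauss_Jordan_Elimination"
    "Graph_Theory.Pair_Digraph"
begin

text \<open>
  A finite simple graph is a \<open>pair_graph\<close>: an edge \<open>{u, v}\<close> is the pair of arcs
  \<open>(u, v)\<close>, \<open>(v, u)\<close>, so the degree of a vertex is its out-degree.
\<close>

definition regular_graph :: "nat \<Rightarrow> 'a pair_pre_digraph \<Rightarrow> bool" where
  "regular_graph r G \<longleftrightarrow> (\<forall>v \<in> pverts G. out_degree (with_proj G) v = r)"

text \<open>The copy of \<open>G\<^sub>2\<close> belonging to the vertex \<open>v\<close> of \<open>G\<^sub>1\<close> has the vertices \<open>Inr (v, b)\<close>.\<close>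

definition neighbourhood_corona ::
    "'a pair_pre_digraph \<Rightarrow> 'b pair_pre_digraph \<Rightarrow> ('a + 'a \<times> 'b) pair_pre_digraph"
    (infixl \<open>\<star>\<close> 70) where
  "G\<^sub>1 \<star> G\<^sub>2 =
    \<lparr> pverts = Inl ` pverts G\<^sub>1 \<union> Inr ` (pverts G\<^sub>1 \<times> pverts G\<^sub>2),
      parcs = {(Inl u, Inl v) | u v. (u, v) \<in> parcs G\<^sub>1}
            \<union> {(Inr (v, a), Inr (v, b)) | v a b. v \<in> pverts G\<^sub>1 \<and> (a, b) \<in> parcs G\<^sub>2}
            \<union> {(Inl u, Inr (v, b)) | u v b. (v, u) \<in> parcs G\<^sub>1 \<and> b \<in> pverts G\<^sub>2}
            \<union> {(Inr (v, b), Inl u) | u v b. (v, u) \<in> parcs G\<^sub>1 \<and> b \<in> pverts G\<^sub>2} \<rparr>"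

lemma pair_graph_neighbourhood_corona:
  assumes "pair_graph G\<^sub>1" "pair_graph G\<^sub>2"
  shows "pair_graph (G\<^sub>1 \<star> G\<^sub>2)"
proof -
  interpret G1: pair_graph G\<^sub>1 by fact
  interpret G2: pair_graph G\<^sub>2 by fact
  have s1: "(v, u) \<in> parcs G\<^sub>1" if "(u, v) \<in> parcs G\<^sub>1" for u v
    using G1.pair_sym_arcs that by (auto simp: symmetric_def dest: symD)
  have s2: "(v, u) \<in> parcs G\<^sub>2" if "(u, v) \<in> parcs G\<^sub>2" for u v
    using G2.pair_sym_arcs that by (auto simp: symmetric_def dest: symD)
  have wf: "parcs (G\<^sub>1 \<star> G\<^sub>2) \<subseteq> pverts (G\<^sub>1 \<star> G\<^sub>2) \<times> pverts (G\<^sub>1 \<star> G\<^sub>2)"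
    by (auto simp: neighbourhood_corona_def dest: G1.in_arcsD1 G1.in_arcsD2 G2.in_arcsD1 G2.in_arcsD2)
  have fin: "finite (pverts (G\<^sub>1 \<star> G\<^sub>2))"
    by (simp add: neighbourhood_corona_def G1.pair_finite_verts G2.pair_finite_verts)
  show ?thesis
  proof unfold_locales
    show "finite (parcs (G\<^sub>1 \<star> G\<^sub>2))"
      using finite_subset[OF wf] fin by simp
    show "symmetric (with_proj (G\<^sub>1 \<star> G\<^sub>2))"
      unfolding symmetric_def with_proj_simps
      by (rule symI) (auto simp: neighbourhood_corona_def intro: s1 s2)
    show "fst e \<noteq> snd e" if "e \<in> parcs (G\<^sub>1 \<star> G\<^sub>2)" for e
      using that G1.pair_no_loops G2.pair_no_loops
      by (fastforce simp: neighbourhood_corona_def)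
  qed (use wf fin in auto)
qed

text \<open>Rows and columns are indexed along an enumeration \<open>vs\<close> of the vertices, from 0.\<close>

definition vertex_enumeration :: "'a list \<Rightarrow> 'a pair_pre_digraph \<Rightarrow> bool" where
  "vertex_enumeration vs G \<longleftrightarrow> distinct vs \<and> set vs = pverts G"

definition adjacency_matrix :: "'a list \<Rightarrow> 'a pair_pre_digraph \<Rightarrow> real mat" where
  "adjacency_matrix vs G =
    mat (length vs) (length vs) (\<lambda>(i, j). if (vs ! i, vs ! j) \<in> parcs G then 1 else 0)"

definition degree_matrix :: "'a list \<Rightarrow> 'a pair_pre_digraph \<Rightarrow> real mat" where
  "degree_matrix vs G =
    mat (length vs) (length vs)
      (\<lambda>(i, j). if i = j then real (out_degree (with_proj G) (vs ! i)) else 0)"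

definition laplacian_matrix :: "'a list \<Rightarrow> 'a pair_pre_digraph \<Rightarrow> real mat" where
  "laplacian_matrix vs G = degree_matrix vs G - adjacency_matrix vs G"

text \<open>
  In non-decreasing order and with algebraic multiplicity. Only real roots of the characteristic
  polynomial are listed; for a symmetric matrix these are all of them.
\<close>

definition real_eigenvalues :: "real mat \<Rightarrow> real list" where
  "real_eigenvalues M = sorted_list_of_multiset (proots (char_poly M))"

type_synonym ratfun = "real poly fract"

definition rf_const :: "real \<Rightarrow> ratfun" where
  "rf_const c = to_fract [:c:]"

definition rf_X :: ratfun where
  "rf_X = to_fract [:0, 1:]"

text \<open>
  \<open>\<phi>(M; y)\<close> and \<open>\<Gamma>\<^sub>M(y)\<close> take a rational function \<open>y\<close> as argument, so that replacing
  the indeterminate \<open>x\<close> by \<open>x - r\<close> is application to \<open>rf_X - rf_const r\<close>.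
\<close>

definition phi :: "real mat \<Rightarrow> ratfun \<Rightarrow> ratfun" where
  "phi M y = poly (map_poly rf_const (char_poly M)) y"

text \<open>
  \<open>y I - M\<close> is invertible unless \<open>y\<close> is an eigenvalue of \<open>M\<close>, in particular for every
  non-constant \<open>y\<close> (constants are the only elements algebraic over the reals), so
  \<open>mat_inverse\<close> does not return \<open>None\<close> there.
\<close>

definition coronal :: "real mat \<Rightarrow> ratfun \<Rightarrow> ratfun" where
  "coronal M y =
    (let n = dim_row M; ones = vec n (\<lambda>_. 1)
     in ones \<bullet> (the (mat_inverse (y \<cdot>\<^sub>m 1\<^sub>m n - map_mat rf_const M)) *\<^sub>v ones))"

end

theory Submission
  imports Defs "Jordan_Normal_Form.Schur_Decomposition"
begin

text \<open>
  List the vertices of the corona as \<open>G\<^sub>1\<close> followed by the copies of \<open>G\<^sub>2\<close>. With \<open>A = A(G\<^sub>1) = r\<^sub>1 I - L(G\<^sub>1)\<close>,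
  \<open>N = (x - r\<^sub>1) I - L(G\<^sub>2)\<close> and \<open>1\<close> the all-ones column, \<open>x I - L(G\<^sub>1 \<star> G\<^sub>2)\<close> is the block matrix with
  rows \<open>((x - n\<^sub>2 r\<^sub>1) I - L(G\<^sub>1), A \<otimes> 1\<^sup>T)\<close> and \<open>(A \<otimes> 1, I \<otimes> N)\<close>. The Schur complement of \<open>I \<otimes> N\<close> is
  \<open>(x - n\<^sub>2 r\<^sub>1) I - L(G\<^sub>1) - \<Gamma> A\<^sup>2\<close>, since \<open>1\<^sup>T N\<^sup>-\<^sup>1 1 = \<Gamma>\<close>. It is a polynomial in the real symmetric matrix \<open>L(G\<^sub>1)\<close>,
  and triangularizing the latter over the reals gives its determinant as a product over the
  eigenvalues.
\<close>

subsection \<open>Block determinants and Kronecker products\<close>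

text \<open>The permutation acts once on the rows and once on the columns, so its sign enters
  squared. This makes the characteristic polynomial of a Laplacian independent of the vertex
  enumeration.\<close>

lemma det_permute_rows_cols:
  assumes A: "A \<in> carrier_mat n n" and p: "p permutes {0..<n}"
  shows "det (mat n n (\<lambda>(i, j). A $$ (p i, p j))) = (det A :: 'a :: comm_ring_1)"
proof -
  define B where "B = mat n n (\<lambda>(i, j). A $$ (p i, j))"
  have B: "B \<in> carrier_mat n n" by (simp add: B_def)
  have "mat n n (\<lambda>(i, j). A $$ (p i, p j)) = (mat n n (\<lambda>(i, j). B\<^sup>T $$ (p i, j)))\<^sup>T"
    using A permutes_in_image[OF p] by (intro eq_matI) (auto simp: B_def)
  hence "det (mat n n (\<lambda>(i, j). A $$ (p i, p j))) = signof p * det B"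
    using B by (simp add: det_transpose[where n = n] det_permute_rows[OF _ p])
  also have "\<dots> = signof p * signof p * det A"
    by (simp add: B_def det_permute_rows[OF A p] mult.assoc)
  finally show ?thesis by (simp add: sign_def)
qed

text \<open>Right multiplication by the unit lower triangular block matrix \<open>?T\<close> has no
  effect on the determinant and clears the lower left block, because \<open>D * E * C = C\<close>.
  What remains is block upper triangular, with the Schur complement of \<open>D\<close> in the upper
  left corner.\<close>

lemma det_schur_complement:
  fixes A :: "'a :: idom mat"
  assumes A: "A \<in> carrier_mat n n" and B: "B \<in> carrier_mat n m"
    and C: "C \<in> carrier_mat m n" and D: "D \<in> carrier_mat m m"
    and E: "E \<in> carrier_mat m m" and DE: "D * E = 1\<^sub>m m"
  shows "det (four_block_mat A B C D) = det D * det (A - B * E * C)"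
proof -
  let ?T = "four_block_mat (1\<^sub>m n) (0\<^sub>m n m) (- (E * C)) (1\<^sub>m m)"
  have EC: "- (E * C) \<in> carrier_mat m n" using E C by auto
  have "det ?T = 1"
    by (subst det_four_block_mat_upper_right_zero[OF _ refl EC]) auto
  hence "det (four_block_mat A B C D) = det (four_block_mat A B C D * ?T)"
    using det_mult[OF four_block_carrier_mat[OF A D] four_block_carrier_mat[OF one_carrier_mat one_carrier_mat]]
    by simp
  also have "four_block_mat A B C D * ?T =
      four_block_mat (A * 1\<^sub>m n + B * (- (E * C))) (A * 0\<^sub>m n m + B * 1\<^sub>m m)
        (C * 1\<^sub>m n + D * (- (E * C))) (C * 0\<^sub>m n m + D * 1\<^sub>m m)"
    by (rule mult_four_block_mat[OF A B C D one_carrier_mat zero_carrier_mat EC one_carrier_mat])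
  also have "D * (- (E * C)) = - C"
  proof -
    have "D * (E * C) = C"
      using assoc_mult_mat[OF D E C] C DE by simp
    thus ?thesis using D E C by simp
  qed
  also have "A * 1\<^sub>m n + B * (- (E * C)) = A - B * E * C"
    using A B C E by (auto simp: assoc_mult_mat[of B n m E m C n] minus_add_uminus_mat[of _ n n])
  also have "C * 1\<^sub>m n + - C = 0\<^sub>m m n" 
    using C by (auto)
  also have "det (four_block_mat (A - B * E * C) (A * 0\<^sub>m n m + B * 1\<^sub>m m)
      (0\<^sub>m m n) (C * 0\<^sub>m n m + D * 1\<^sub>m m)) = det (A - B * E * C) * det D"
    using A B C D E by (subst det_four_block_mat_lower_left_zero[where n = n and m = m]) auto
  finally show ?thesis by simp
qed

text \<open>In an index, \<open>div\<close> selects the block and \<open>mod\<close> the position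
  inside it. The vertices in the copies of the second graph are numbered by the same convention
  below.\<close>

definition kronecker :: "'a :: semiring_0 mat \<Rightarrow> 'a mat \<Rightarrow> 'a mat" where
  "kronecker A B = mat (dim_row A * dim_row B) (dim_col A * dim_col B)
    (\<lambda>(i, j). A $$ (i div dim_row B, j div dim_col B) * B $$ (i mod dim_row B, j mod dim_col B))"

lemma kronecker_carrier [simp]:
  "A \<in> carrier_mat a b \<Longrightarrow> B \<in> carrier_mat c d \<Longrightarrow> kronecker A B \<in> carrier_mat (a * c) (b * d)"
  by (auto simp: kronecker_def)

lemma mod_less_of_less_mult: "(i::nat) < a * b \<Longrightarrow> i mod b < b"
  by (cases "b = 0") auto

lemma index_kronecker:
  assumes "A \<in> carrier_mat a b" "B \<in> carrier_mat c d" "i < a * c" "j < b * d"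
  shows "kronecker A B $$ (i, j) = A $$ (i div c, j div d) * B $$ (i mod c, j mod d)"
  using assms by (auto simp: kronecker_def)

text \<open>The range below \<open>a * b\<close> is cut into \<open>a\<close> intervals of length
  \<open>b\<close>; on the \<open>i\<close>th one the quotient is constantly \<open>i\<close> and
  the remainder runs through all values below \<open>b\<close>.\<close>

lemma sum_div_mod:
  "(\<Sum>k<a * b. f (k div b) (k mod b)) = (\<Sum>i<a. \<Sum>j<b. f i (j::nat))" for a :: nat
proof -
  have "(\<Sum>k = i * b..<i * b + b. f (k div b) (k mod b)) = (\<Sum>j<b. f i j)" for i
    by (rule sum.reindex_bij_witness[of _ "\<lambda>j. i * b + j" "\<lambda>k. k - i * b"])
      (auto simp: less_diff_conv2 le_iff_add)
  thus ?thesis by (simp add: sum.nat_group[symmetric])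
qed

text \<open>The mixed-product rule. The inner summation index splits into quotient and remainder,
  and by commutativity the double sum factors into one entry of each product.\<close>

lemma kronecker_mult:
  fixes A :: "'a :: comm_semiring_0 mat"
  assumes A: "A \<in> carrier_mat a b" and B: "B \<in> carrier_mat c d"
    and C: "C \<in> carrier_mat b e" and D: "D \<in> carrier_mat d f"
  shows "kronecker A B * kronecker C D = kronecker (A * C) (B * D)"
proof (rule eq_matI)
  note AB = kronecker_carrier[OF A B] and CD = kronecker_carrier[OF C D]
  have AC: "A * C \<in> carrier_mat a e" and BD: "B * D \<in> carrier_mat c f" using assms by auto
  note ACBD = kronecker_carrier[OF AC BD]
  fix i j assume "i < dim_row (kronecker (A * C) (B * D))" "j < dim_col (kronecker (A * C) (B * D))"
  hence ij: "i < a * c" "j < e * f" using ACBD by auto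
  note lt = less_mult_imp_div_less[OF ij(1)] mod_less_of_less_mult[OF ij(1)]
    less_mult_imp_div_less[OF ij(2)] mod_less_of_less_mult[OF ij(2)]
  have "(kronecker A B * kronecker C D) $$ (i, j) =
      (\<Sum>k<b * d. kronecker A B $$ (i, k) * kronecker C D $$ (k, j))"
    using AB CD ij by (auto simp: scalar_prod_def atLeast0LessThan intro!: sum.cong)
  also have "\<dots> = (\<Sum>k<b * d. (\<lambda>k l. (A $$ (i div c, k) * B $$ (i mod c, l)) *
      (C $$ (k, j div f) * D $$ (l, j mod f))) (k div d) (k mod d))"
    by (rule sum.cong) (auto simp: index_kronecker[OF A B ij(1)] index_kronecker[OF C D _ ij(2)])
  also have "\<dots> = (\<Sum>k<b. A $$ (i div c, k) * C $$ (k, j div f)) *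
      (\<Sum>l<d. B $$ (i mod c, l) * D $$ (l, j mod f))"
    by (subst sum_div_mod) (simp add: sum_product ac_simps)
  also have "\<dots> = kronecker (A * C) (B * D) $$ (i, j)"
    using assms lt ij by (auto simp: index_kronecker[OF AC BD] scalar_prod_def atLeast0LessThan)
  finally show "(kronecker A B * kronecker C D) $$ (i, j) = kronecker (A * C) (B * D) $$ (i, j)" .
qed (use assms in \<open>auto simp: kronecker_def\<close>)

lemma kronecker_one: "kronecker (1\<^sub>m n) (1\<^sub>m m) = (1\<^sub>m (n * m) :: 'a :: semiring_1 mat)"
proof (rule eq_matI)
  fix i j assume "i < dim_row (1\<^sub>m (n * m) :: 'a mat)" "j < dim_col (1\<^sub>m (n * m) :: 'a mat)"
  hence ij: "i < n * m" "j < n * m" by auto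
  have "i = j" if "i div m = j div m" "i mod m = j mod m"
    using that by (metis div_mult_mod_eq)
  thus "kronecker (1\<^sub>m n) (1\<^sub>m m) $$ (i, j) = (1\<^sub>m (n * m) :: 'a mat) $$ (i, j)"
    using ij by (auto simp: kronecker_def less_mult_imp_div_less mod_less_of_less_mult)
qed (auto simp: kronecker_def)

text \<open>The matrix is block diagonal with \<open>n\<close> copies of \<open>N\<close>; the
  induction splits off the first copy.\<close>

lemma det_kronecker_one:
  fixes N :: "'a :: idom mat"
  assumes N: "N \<in> carrier_mat m m"
  shows "det (kronecker (1\<^sub>m n) N) = det N ^ n"
proof (induction n)
  case 0
  have "kronecker (1\<^sub>m 0) N \<in> carrier_mat 0 0" using N by (auto simp: kronecker_def)
  thus ?case using det_dim_zero by simp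
next
  case (Suc n)
  \<comment> \<open>Moving back by one block lowers the quotient by one and keeps the remainder. For
    \<open>m = 0\<close> the two conditions on \<open>i\<close> contradict each other.\<close>
  have d: "i div m = Suc ((i - m) div m)" "i mod m = (i - m) mod m"
    if "\<not> i < m" "i < m + n * m" for i
    using that by (cases "m = 0"; simp add: le_div_geq le_mod_geq)+
  have K: "kronecker (1\<^sub>m n) N \<in> carrier_mat (n * m) (n * m)" using N by simp
  have eq: "kronecker (1\<^sub>m (Suc n)) N =
      four_block_mat N (0\<^sub>m m (n * m)) (0\<^sub>m (n * m) m) (kronecker (1\<^sub>m n) N)"
    (is "_ = ?F")
  proof (rule eq_matI)
    fix i j assume "i < dim_row ?F" "j < dim_col ?F"
    hence ij: "i < m + n * m" "j < m + n * m" using N by (auto simp: kronecker_def)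
    thus "kronecker (1\<^sub>m (Suc n)) N $$ (i, j) = ?F $$ (i, j)"
      using N less_mult_imp_div_less[of i "Suc n" m] less_mult_imp_div_less[of j "Suc n" m]
        less_mult_imp_div_less[of "i - m" n m] less_mult_imp_div_less[of "j - m" n m]
      by (cases "i < m"; cases "j < m") (auto simp: kronecker_def d)
  qed (use N in \<open>auto simp: kronecker_def\<close>)
  show ?case
    unfolding eq using N K Suc by (subst det_four_block_mat_lower_left_zero[of _ m _ "n * m"]) auto
qed

subsection \<open>Real symmetric matrices over the rational functions\<close>

lemma proots_prod_linear_factors:
  "proots (\<Prod>a\<leftarrow>as. [:- a, 1:]) = mset (as :: 'a :: idom list)"
proof (induction as)
  case (Cons a as)
  have "(\<Prod>a\<leftarrow>as. [:- a, 1:]) \<noteq> 0" by (auto simp: prod_list_zero_iff)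
  with Cons show ?case by (simp add: proots_mult del: mult_pCons_left)
qed simp

text \<open>\<open>real_eigenvalues\<close> collects real roots only, so it must be shown that a
  symmetric matrix has no others. Over the complex numbers the characteristic polynomial splits,
  every root is self-conjugate, and the factorization descends to the reals.\<close>

lemma char_poly_symmetric_splits:
  fixes M :: "real mat"
  assumes M: "M \<in> carrier_mat n n" and sym: "M\<^sup>T = M"
  shows "char_poly M = (\<Prod>e\<leftarrow>real_eigenvalues M. [:- e, 1:])"
    and "length (real_eigenvalues M) = n"
proof -
  let ?C = "map_mat complex_of_real M"
  have C: "?C \<in> carrier_mat n n" using M by simp
  obtain as where as: "char_poly ?C = (\<Prod>a\<leftarrow>as. [:- a, 1:])" and len: "length as = n"
    using char_poly_factorized[OF C] by blast
  have real: "complex_of_real (Re a) = a" if "a \<in> set as" for a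
  proof -
    have "poly (char_poly ?C) a = 0"
      using that unfolding as by (auto simp: poly_prod_list prod_list_zero_iff)
    then obtain v where "eigenvector ?C v a"
      using eigenvalue_root_char_poly[OF C] by (auto simp: eigenvalue_def)
    hence v: "v \<in> carrier_vec n" and v0: "v \<noteq> 0\<^sub>v n" and ev: "?C *\<^sub>v v = a \<cdot>\<^sub>v v"
      using M by (auto simp: eigenvector_def)
    have ev': "(\<Sum>j<n. complex_of_real (M $$ (i, j)) * v $ j) = a * v $ i" if "i < n" for i
      using arg_cong[OF ev, of "\<lambda>w. w $ i"] that M v
      by (auto simp: scalar_prod_def atLeast0LessThan)
    have symi: "M $$ (i, j) = M $$ (j, i)" if "i < n" "j < n" for i j
      using arg_cong[OF sym, of "\<lambda>A. A $$ (i, j)"] that M by auto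
    \<comment> \<open>\<open>s\<close> is the squared norm of the eigenvector. The form pairing
      \<open>?C *\<^sub>v v\<close> with \<open>v\<close> equals \<open>a * s\<close>; moving the
      real symmetric matrix to the conjugated factor turns it into \<open>cnj a * s\<close>.\<close>
    define s where "s = (\<Sum>i<n. v $ i * cnj (v $ i))"
    have "a * s = (\<Sum>i<n. (\<Sum>j<n. complex_of_real (M $$ (i, j)) * v $ j) * cnj (v $ i))"
      unfolding s_def sum_distrib_left by (rule sum.cong) (auto simp: ev')
    also have "\<dots> = (\<Sum>j<n. \<Sum>i<n. complex_of_real (M $$ (i, j)) * v $ j * cnj (v $ i))"
      unfolding sum_distrib_right by (rule sum.swap)
    also have "\<dots> = (\<Sum>j<n. v $ j * cnj (\<Sum>i<n. complex_of_real (M $$ (j, i)) * v $ i))"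
      by (auto simp: sum_distrib_left symi intro!: sum.cong)
    also have "\<dots> = cnj a * s"
      unfolding s_def sum_distrib_left by (rule sum.cong) (auto simp: ev')
    finally have "a * s = cnj a * s" .
    moreover have "s \<noteq> 0"
    proof
      assume "s = 0"
      hence "complex_of_real (\<Sum>i<n. (cmod (v $ i))\<^sup>2) = 0"
        unfolding s_def complex_norm_square of_real_sum .
      hence "(\<Sum>i<n. (cmod (v $ i))\<^sup>2) = 0" by (simp only: of_real_eq_0_iff)
      hence "\<forall>i<n. v $ i = 0" by (subst (asm) sum_nonneg_eq_0_iff) auto
      thus False using v v0 by (auto intro!: eq_vecI)
    qed
    ultimately have "cnj a = a" by simp
    thus ?thesis by (simp add: complex_eq_iff)
  qed
  \<comment> \<open>Injectivity of the embedding of real into complex polynomials allows the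
    factorization to be pulled back.\<close>
  interpret map_poly_of_real: map_poly_inj_idom_hom complex_of_real ..
  have "map_poly complex_of_real (char_poly M) = char_poly ?C"
    by (rule of_real_hom.char_poly_hom[OF M, symmetric])
  also have "\<dots> = (\<Prod>a\<leftarrow>as. map_poly complex_of_real [:- Re a, 1:])"
    unfolding as using real by (intro arg_cong[of _ _ prod_list] map_cong) (auto simp: map_poly_pCons)
  also have "\<dots> = map_poly complex_of_real (\<Prod>a\<leftarrow>map Re as. [:- a, 1:])"
    by (induction as) (simp_all add: map_poly_of_real.hom_mult map_poly_pCons del: mult_pCons_left)
  finally have cp: "char_poly M = (\<Prod>a\<leftarrow>map Re as. [:- a, 1:])"
    by (rule map_poly_of_real.injectivity)
  \<comment> \<open>\<open>map Re as\<close> and the sorted list \<open>real_eigenvalues M\<close>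
    may differ in order. Equality as multisets suffices for both the length and the product.\<close>
  have "proots (char_poly M) = mset (map Re as)"
    unfolding cp by (rule proots_prod_linear_factors)
  hence ms: "mset (real_eigenvalues M) = mset (map Re as)"
    by (simp add: real_eigenvalues_def)
  show "length (real_eigenvalues M) = n"
    using arg_cong[OF ms, of size] len by simp
  show "char_poly M = (\<Prod>e\<leftarrow>real_eigenvalues M. [:- e, 1:])"
    unfolding cp prod_mset_prod_list[symmetric] mset_map[of "\<lambda>e. [:- e, 1:]"] ms ..
qed

section \<open>Characteristic polynomials evaluated at rational functions\<close>

interpretation rf_const: inj_idom_hom rf_const
proof
  show "rf_const 1 = 1" unfolding rf_const_def one_pCons[symmetric] by simp
qed (auto simp: rf_const_def simp flip: to_fract_add to_fract_mult)

text \<open>Substituting \<open>y\<close> into a polynomial is a ring homomorphism and hence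
  commutes with the determinant.\<close>

lemma phi_conv_det:
  assumes M: "M \<in> carrier_mat n n"
  shows "phi M y = det (y \<cdot>\<^sub>m 1\<^sub>m n - map_mat rf_const M)"
proof -
  interpret map_rf: map_poly_comm_ring_hom rf_const ..
  interpret eval: comm_ring_hom "\<lambda>p. poly (map_poly rf_const p) y"
    by unfold_locales (auto simp: hom_distribs)
  have "map_mat (\<lambda>p. poly (map_poly rf_const p) y) (char_poly_matrix M) =
      y \<cdot>\<^sub>m 1\<^sub>m n - map_mat rf_const M"
    using M by (intro eq_matI) (auto simp: char_poly_matrix_def hom_distribs)
  thus ?thesis
    unfolding phi_def char_poly_def eval.hom_det[symmetric] by simp
qed

lemma poly_rf_const_shift:
  "poly (map_poly rf_const p) (rf_X - rf_const r) = to_fract (pcompose p [:- r, 1:])"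
proof (induction p)
  case (pCons a p)
  have "rf_X - rf_const r = to_fract [:- r, 1:]"
    by (simp add: rf_X_def rf_const_def flip: to_fract_diff)
  with pCons show ?case
    by (simp add: map_poly_pCons pcompose_pCons) (simp add: rf_const_def flip: to_fract_mult to_fract_add to_fract_diff)
qed simp

text \<open>A monic polynomial stays nonzero under composition with the non-constant
  \<open>x - r\<close>. Hence the matrix inverse in the coronal exists at
  \<open>x - r\<close>.\<close>

lemma phi_shift_nonzero:
  assumes "M \<in> carrier_mat n n"
  shows "phi M (rf_X - rf_const r) \<noteq> 0"
proof -
  have "char_poly M \<noteq> 0" using degree_monic_char_poly[OF assms] by auto
  hence "pcompose (char_poly M) [:- r, 1:] \<noteq> 0" by (subst pcompose_eq_0_iff) auto
  thus ?thesis by (simp add: phi_def poly_rf_const_shift)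
qed

lemma mat_inverse_Some:
  fixes A :: "'a :: field mat"
  assumes A: "A \<in> carrier_mat n n" and "det A \<noteq> 0"
  obtains B where "mat_inverse A = Some B" "B \<in> carrier_mat n n" "A * B = 1\<^sub>m n"
proof (cases "mat_inverse A")
  case None
  \<comment> \<open>\<open>b\<close> only fills the extension slot of the matrix ring record; both
    facts must speak of the same ring.\<close>
  from mat_inverse(1)[OF A None, where b = "()"] det_non_zero_imp_unit[OF assms, where b = "()"] show ?thesis by blast
next
  case (Some B)
  from mat_inverse(2)[OF A Some] Some that show ?thesis by blast
qed

section \<open>Triangularization and the determinant of a quadratic in a symmetric matrix\<close>

lemma upper_triangular_mult:
  fixes A :: "'a :: semiring_0 mat"
  assumes A: "A \<in> carrier_mat n n" "upper_triangular A" and B: "B \<in> carrier_mat n n" "upper_triangular B"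
  shows "upper_triangular (A * B)"
    and "i < n \<Longrightarrow> (A * B) $$ (i, i) = A $$ (i, i) * B $$ (i, i)"
proof -
  \<comment> \<open>Only terms with \<open>i \<le> k \<le> j\<close> can survive: none below the
    diagonal, and just \<open>k = i\<close> on it.\<close>
  have AB: "A $$ (i, k) * B $$ (k, j) = 0" if "k < n" "i < n" "j < n" "k < i \<or> j < k" for i j k
    using that A B by (auto dest: upper_triangularD)
  have idx: "(A * B) $$ (i, j) = (\<Sum>k<n. A $$ (i, k) * B $$ (k, j))" if "i < n" "j < n" for i j
    using that A B by (auto simp: scalar_prod_def atLeast0LessThan)
  show "upper_triangular (A * B)"
  proof (rule upper_triangularI)
    fix i j assume "j < i" "i < dim_row (A * B)"
    thus "(A * B) $$ (i, j) = 0"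
      using A by (subst idx) (auto intro!: sum.neutral AB)
  qed
  assume i: "i < n"
  have "(A * B) $$ (i, i) = (\<Sum>k\<in>{i}. A $$ (i, k) * B $$ (k, i))"
    unfolding idx[OF i i]
    by (rule sum.mono_neutral_right) (use i in \<open>auto intro!: AB\<close>)
  thus "(A * B) $$ (i, i) = A $$ (i, i) * B $$ (i, i)" by simp
qed

text \<open>Conjugating \<open>K\<close> to triangular form makes the whole quadratic expression
  triangular at once, and its diagonal is that expression evaluated at the eigenvalues. With
  \<open>r\<close> the degree and \<open>M\<close> the Laplacian of a regular graph,
  \<open>R\<close> is the adjacency matrix.\<close>

lemma det_quadratic_symmetric:
  fixes M :: "real mat" and r c g :: ratfun
  assumes M: "M \<in> carrier_mat n n" and sym: "M\<^sup>T = M"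
  defines "K \<equiv> map_mat rf_const M"
  defines "R \<equiv> r \<cdot>\<^sub>m 1\<^sub>m n - K"
  shows "det (c \<cdot>\<^sub>m 1\<^sub>m n - K - g \<cdot>\<^sub>m (R * R)) =
    (\<Prod>i<n. c - rf_const (real_eigenvalues M ! i) - g * (r - rf_const (real_eigenvalues M ! i))\<^sup>2)"
proof -
  note split = char_poly_symmetric_splits[OF M sym]
  obtain B P Q where wit: "similar_mat_wit M B P Q" and ut: "upper_triangular B"
    and diag: "diag_mat B = real_eigenvalues M"
    using schur_decomposition[OF M split(1)] by (metis prod_cases3)
  note w = similar_mat_witD2[OF M wit]
  have B: "B \<in> carrier_mat n n" and P: "P \<in> carrier_mat n n" and Q: "Q \<in> carrier_mat n n"
    using w by auto
  \<comment> \<open>The scalars \<open>r\<close>, \<open>c\<close> and \<open>g\<close> are rational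
    functions, so the triangularization found over the reals is carried over to that field.\<close>
  define B' P' Q' where "B' = map_mat rf_const B" "P' = map_mat rf_const P" "Q' = map_mat rf_const Q"
  have B': "B' \<in> carrier_mat n n" and P': "P' \<in> carrier_mat n n" and Q': "Q' \<in> carrier_mat n n"
    and K: "K \<in> carrier_mat n n" and R: "R \<in> carrier_mat n n"
    using B P Q M by (auto simp: B'_P'_Q'_def K_def R_def)
  have PQ: "P' * Q' = 1\<^sub>m n"
    unfolding B'_P'_Q'_def using w P Q by (metis rf_const.mat_hom_mult rf_const.mat_hom_one)
  have QP: "Q' * P' = 1\<^sub>m n"
    unfolding B'_P'_Q'_def using w P Q by (metis rf_const.mat_hom_mult rf_const.mat_hom_one)
  have KB: "K = P' * B' * Q'"
    unfolding B'_P'_Q'_def K_def using w B P Q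
    by (metis mult_carrier_mat rf_const.mat_hom_mult)
  define R' where "R' = r \<cdot>\<^sub>m 1\<^sub>m n - B'"
  have R': "R' \<in> carrier_mat n n" using B' unfolding R'_def by (rule minus_carrier_mat)
  have lin: "P' * (a \<cdot>\<^sub>m 1\<^sub>m n - Z) * Q' = a \<cdot>\<^sub>m 1\<^sub>m n - P' * Z * Q'" if Z: "Z \<in> carrier_mat n n" for a Z
  proof -
    have "P' * (a \<cdot>\<^sub>m 1\<^sub>m n - Z) = a \<cdot>\<^sub>m P' - P' * Z"
      using P' Z by (subst mult_minus_distrib_mat[of _ n n]) (auto simp: mult_smult_distrib[of _ n n])
    also have "\<dots> * Q' = a \<cdot>\<^sub>m 1\<^sub>m n - P' * Z * Q'"
      using P' Z Q' PQ mult_smult_assoc_mat[of P' n n Q' n a]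
      by (subst minus_mult_distrib_mat[of _ n n]) auto
    finally show ?thesis .
  qed
  have RR: "R = P' * R' * Q'"
    unfolding R_def R'_def KB lin[OF B'] ..
  have RR2: "R * R = P' * (R' * R') * Q'"
  proof -
    have "R * R = P' * R' * (Q' * P') * R' * Q'"
      unfolding RR using P' Q' R' by (simp add: assoc_mult_mat[of _ n n _ n _ n])
    thus ?thesis using P' Q' R' by (simp add: QP assoc_mult_mat[of _ n n _ n _ n])
  qed
  \<comment> \<open>The two subtracted terms are grouped so that \<open>T\<close> has the shape to
    which \<open>lin\<close> applies.\<close>
  define T where "T = c \<cdot>\<^sub>m 1\<^sub>m n - (B' + g \<cdot>\<^sub>m (R' * R'))"
  have T: "T \<in> carrier_mat n n" using B' R' unfolding T_def by (intro minus_carrier_mat add_carrier_mat) auto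
  have g: "P' * (g \<cdot>\<^sub>m (R' * R')) * Q' = g \<cdot>\<^sub>m (P' * (R' * R') * Q')"
    using mult_smult_distrib[of P' n n "R' * R'" n g] mult_smult_assoc_mat[of "P' * (R' * R')" n n Q' n g]
      P' Q' R' by simp
  have "P' * T * Q' = c \<cdot>\<^sub>m 1\<^sub>m n - (K + g \<cdot>\<^sub>m (R * R))"
    unfolding T_def KB RR2 using B' R' P' Q'
    by (subst lin) (auto simp: mult_add_distrib_mat[of _ n n] add_mult_distrib_mat[of _ n n] g)
  also have "\<dots> = c \<cdot>\<^sub>m 1\<^sub>m n - K - g \<cdot>\<^sub>m (R * R)"
    using K R by (intro eq_matI) auto
  finally have eq: "c \<cdot>\<^sub>m 1\<^sub>m n - K - g \<cdot>\<^sub>m (R * R) = P' * T * Q'" ..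
  have "similar_mat (c \<cdot>\<^sub>m 1\<^sub>m n - K - g \<cdot>\<^sub>m (R * R)) T"
    unfolding similar_mat_def
    by (intro exI, rule similar_mat_witI[OF PQ QP eq _ T P' Q'])
      (use R in \<open>intro minus_carrier_mat smult_carrier_mat mult_carrier_mat\<close>)
  hence "det (c \<cdot>\<^sub>m 1\<^sub>m n - K - g \<cdot>\<^sub>m (R * R)) = det T" by (rule det_similar)
  have utB: "upper_triangular B'"
    using ut B by (auto simp: B'_P'_Q'_def intro!: upper_triangularI dest: upper_triangularD)
  have utR: "upper_triangular R'"
    using utB B' by (auto simp: R'_def intro!: upper_triangularI dest: upper_triangularD)
  note RRt = upper_triangular_mult[OF R' utR R' utR]
  have utT: "upper_triangular T"
    using upper_triangularD[OF utB] upper_triangularD[OF RRt(1)] B' R'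
    by (intro upper_triangularI) (auto simp: T_def simp del: index_mult_mat(1))
  have "det T = (\<Prod>i<n. T $$ (i, i))"
    using T by (simp add: det_upper_triangular[OF utT T] diag_mat_def prod.list_conv_set_nth atLeast0LessThan)
  also have "\<dots> = (\<Prod>i<n. c - rf_const (real_eigenvalues M ! i) - g * (r - rf_const (real_eigenvalues M ! i))\<^sup>2)"
  proof (rule prod.cong)
    fix i assume "i \<in> {..<n}"
    hence i: "i < n" by simp
    have "B $$ (i, i) = real_eigenvalues M ! i"
      unfolding diag[symmetric] using B i by (simp add: diag_mat_def)
    thus "T $$ (i, i) = c - rf_const (real_eigenvalues M ! i) - g * (r - rf_const (real_eigenvalues M ! i))\<^sup>2"
      using i B R' RRt(2)[OF i] B
      by (simp add: T_def del: index_mult_mat(1)) (simp add: R'_def B'_P'_Q'_def power2_eq_square)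
  qed simp
  finally show ?thesis using \<open>det (c \<cdot>\<^sub>m 1\<^sub>m n - K - g \<cdot>\<^sub>m (R * R)) = det T\<close> by simp
qed

subsection \<open>Laplacian of the neighbourhood corona\<close>

lemma laplacian_matrix_carrier [simp]:
  "laplacian_matrix vs G \<in> carrier_mat (length vs) (length vs)"
  by (auto simp: laplacian_matrix_def adjacency_matrix_def degree_matrix_def)

lemma index_laplacian_matrix:
  "i < length vs \<Longrightarrow> j < length vs \<Longrightarrow> laplacian_matrix vs G $$ (i, j) =
    (if i = j then real (out_degree (with_proj G) (vs ! i)) else 0)
    - (if (vs ! i, vs ! j) \<in> parcs G then 1 else 0)"
  by (simp add: laplacian_matrix_def adjacency_matrix_def degree_matrix_def)

lemma vertex_enumerationD:
  assumes "vertex_enumeration vs G"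
  shows "distinct vs" "set vs = pverts G" "length vs = card (pverts G)"
  using assms by (auto simp: vertex_enumeration_def dest: distinct_card)

text \<open>Two enumerations of one vertex set differ by a permutation, which acts on rows and
  columns simultaneously. The theorem can therefore be proved for one convenient enumeration of the
  corona.\<close>

lemma phi_laplacian_enumeration_cong:
  assumes "vertex_enumeration xs G" and "vertex_enumeration ys G"
  shows "phi (laplacian_matrix xs G) y = phi (laplacian_matrix ys G) y"
proof -
  have "mset xs = mset ys"
    using assms by (metis vertex_enumerationD(1,2) set_eq_iff_mset_eq_distinct)
  then obtain p where p: "p permutes {..<length ys}" and xs: "permute_list p ys = xs"
    by (rule mset_eq_permutation)
  define n where "n = length ys"
  have len: "length xs = n" using xs by (auto simp: n_def)
  have p': "p permutes {0..<n}" using p by (simp add: n_def atLeast0LessThan)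
  have plt: "p i < n" if "i < n" for i using permutes_in_image[OF p'] that by auto
  have nth: "xs ! i = ys ! p i" if "i < n" for i
    using that p by (auto simp: xs[symmetric] n_def permute_list_nth)
  have pinj: "p i = p j \<longleftrightarrow> i = j" for i j
    using permutes_inj[OF p'] by (auto dest: injD)
  define Y where "Y = y \<cdot>\<^sub>m 1\<^sub>m n - map_mat rf_const (laplacian_matrix ys G)"
  have LX: "laplacian_matrix xs G \<in> carrier_mat n n" and LY: "laplacian_matrix ys G \<in> carrier_mat n n"
    using laplacian_matrix_carrier[of xs G] laplacian_matrix_carrier[of ys G]
    by (auto simp: len n_def)
  have Y: "Y \<in> carrier_mat n n" using LY by (auto simp: Y_def intro!: minus_carrier_mat)
  have eq: "y \<cdot>\<^sub>m 1\<^sub>m n - map_mat rf_const (laplacian_matrix xs G) =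
      mat n n (\<lambda>(i, j). Y $$ (p i, p j))"
  proof (rule eq_matI)
    fix i j assume "i < dim_row (mat n n (\<lambda>(i, j). Y $$ (p i, p j)))"
      "j < dim_col (mat n n (\<lambda>(i, j). Y $$ (p i, p j)))"
    hence ij: "i < n" "j < n" by auto
    have "laplacian_matrix xs G $$ (i, j) = laplacian_matrix ys G $$ (p i, p j)"
      using ij plt by (simp add: index_laplacian_matrix len nth pinj flip: n_def)
    thus "(y \<cdot>\<^sub>m 1\<^sub>m n - map_mat rf_const (laplacian_matrix xs G)) $$ (i, j) =
        mat n n (\<lambda>(i, j). Y $$ (p i, p j)) $$ (i, j)"
      using ij plt LX LY by (auto simp: Y_def pinj)
  qed (use LX in auto)
  show ?thesis
    unfolding phi_conv_det[OF LX] phi_conv_det[OF LY] eq det_permute_rows_cols[OF Y p']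
    by (simp add: Y_def)
qed

section \<open>Arcs and degrees in the neighbourhood corona\<close>

lemma pair_graph_arc_sym:
  assumes "pair_graph G" shows "(u, v) \<in> parcs G \<longleftrightarrow> (v, u) \<in> parcs G"
proof -
  interpret pair_graph G by fact
  show ?thesis using pair_sym_arcs by (auto simp: symmetric_def dest: symD)
qed

lemma pair_graph_no_loop:
  assumes "pair_graph G" shows "(v, v) \<notin> parcs G"
proof -
  interpret pair_graph G by fact
  show ?thesis using pair_no_loops[of "(v, v)"] by auto
qed

lemma laplacian_matrix_sym:
  assumes "pair_graph G" shows "(laplacian_matrix vs G)\<^sup>T = laplacian_matrix vs G"
proof -
  have d: "dim_row (laplacian_matrix vs G) = length vs" "dim_col (laplacian_matrix vs G) = length vs"
    by (rule carrier_matD[OF laplacian_matrix_carrier])+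
  show ?thesis
    using pair_graph_arc_sym[OF assms] by (intro eq_matI) (auto simp: d index_laplacian_matrix)
qed

lemma out_degree_pair: "out_degree (with_proj G) v = card {w. (v, w) \<in> parcs G}"
proof -
  have "out_arcs (with_proj G) v = Pair v ` {w. (v, w) \<in> parcs G}"
    by (auto simp: out_arcs_def)
  thus ?thesis by (simp add: out_degree_def card_image inj_on_def)
qed

lemma finite_out_neighbours:
  assumes "pair_graph G" shows "finite {w. (v, w) \<in> parcs G}"
proof -
  interpret pair_graph G by fact
  have "{w. (v, w) \<in> parcs G} \<subseteq> pverts G" by (auto dest: in_arcsD2)
  thus ?thesis using pair_finite_verts finite_subset by blast
qed

text \<open>Each neighbour \<open>w\<close> of \<open>u\<close> contributes itself and all vertices
  of its own copy of \<open>H\<close>.\<close>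

lemma out_degree_corona_Inl:
  assumes "pair_graph G" "pair_graph H"
  shows "out_degree (with_proj (G \<star> H)) (Inl u) =
    out_degree (with_proj G) u * (1 + card (pverts H))"
proof -
  let ?N = "{w. (u, w) \<in> parcs G}"
  have "finite (pverts H)" using assms(2) by (simp add: pair_fin_digraph.pair_finite_verts
        pair_graph_def pair_digraph_def)
  moreover have "{w. (Inl u, w) \<in> parcs (G \<star> H)} = ?N <+> ?N \<times> pverts H"
    using pair_graph_arc_sym[OF assms(1)] by (auto simp: neighbourhood_corona_def Plus_def)
  ultimately show ?thesis
    unfolding out_degree_pair using finite_out_neighbours[OF assms(1), of u]
    by (simp add: card_Plus card_cartesian_product)
qed

text \<open>A copy vertex sees the neighbours of \<open>v\<close> in \<open>G\<close> and the
  neighbours of \<open>b\<close> inside its copy.\<close>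

lemma out_degree_corona_Inr:
  assumes "pair_graph G" "pair_graph H" and "v \<in> pverts G" "b \<in> pverts H"
  shows "out_degree (with_proj (G \<star> H)) (Inr (v, b)) =
    out_degree (with_proj G) v + out_degree (with_proj H) b"
proof -
  have "{w. (Inr (v, b), w) \<in> parcs (G \<star> H)} =
      {w. (v, w) \<in> parcs G} <+> {v} \<times> {w. (b, w) \<in> parcs H}"
    using assms(3,4) by (auto simp: neighbourhood_corona_def Plus_def)
  thus ?thesis
    unfolding out_degree_pair
    using finite_out_neighbours[OF assms(1), of v] finite_out_neighbours[OF assms(2), of b]
    by (simp add: card_Plus card_cartesian_product)
qed

text \<open>The copies follow one another in the order of \<open>vs\<close>, each listed along
  \<open>us\<close>. This matches the indexing of \<open>kronecker\<close>, so the blocks of the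
  Laplacian become Kronecker products.\<close>

definition corona_enumeration :: "'a list \<Rightarrow> 'b list \<Rightarrow> ('a + 'a \<times> 'b) list" where
  "corona_enumeration vs us = map Inl vs @
    map (\<lambda>k. Inr (vs ! (k div length us), us ! (k mod length us))) [0..<length vs * length us]"

lemma vertex_enumeration_corona:
  assumes "vertex_enumeration vs G" "vertex_enumeration us H"
  shows "vertex_enumeration (corona_enumeration vs us) (G \<star> H)"
proof -
  note v = vertex_enumerationD[OF assms(1)] and u = vertex_enumerationD[OF assms(2)]
  let ?f = "\<lambda>k. (vs ! (k div length us), us ! (k mod length us))"
  have inj: "inj_on ?f {..<length vs * length us}"
    by (rule inj_onI) (metis Pair_inject div_mult_mod_eq v(1) u(1) nth_eq_iff_index_eq
        less_mult_imp_div_less mod_less_of_less_mult lessThan_iff)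
  have sub: "?f ` {..<length vs * length us} \<subseteq> pverts G \<times> pverts H"
    using v u by (auto simp: less_mult_imp_div_less mod_less_of_less_mult simp flip: v(2) u(2))
  have "card (?f ` {..<length vs * length us}) = card (pverts G \<times> pverts H)"
    using inj by (simp add: card_image card_cartesian_product v(3) u(3))
  moreover have "finite (pverts G \<times> pverts H)"
    by (simp flip: v(2) u(2))
  ultimately have "?f ` {..<length vs * length us} = pverts G \<times> pverts H"
    using sub by (intro card_subset_eq)
  hence "set (corona_enumeration vs us) = pverts (G \<star> H)"
    unfolding corona_enumeration_def neighbourhood_corona_def
    by (simp add: v(2) atLeast0LessThan image_image flip: image_image[of Inr ?f])
  moreover have "inj_on (Inr \<circ> ?f) {..<length vs * length us}"
    using inj by (rule comp_inj_on) simp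
  hence "distinct (corona_enumeration vs us)"
    using v(1) by (auto simp: corona_enumeration_def distinct_map o_def atLeast0LessThan)
  ultimately show ?thesis by (simp add: vertex_enumeration_def)
qed

text \<open>Replaces \<open>the (mat_inverse ...)\<close> by an actual right inverse and presents
  the coronal as a 1 by 1 matrix product, the form in which it appears in the Schur
  complement.\<close>

lemma coronal_inverse:
  assumes M: "M \<in> carrier_mat m m" and nz: "phi M y \<noteq> 0"
  obtains E where "E \<in> carrier_mat m m"
    "(y \<cdot>\<^sub>m 1\<^sub>m m - map_mat rf_const M) * E = 1\<^sub>m m"
    "mat 1 m (\<lambda>_. 1) * E * mat m 1 (\<lambda>_. 1) = mat 1 1 (\<lambda>_. coronal M y)"
proof -
  let ?N = "y \<cdot>\<^sub>m 1\<^sub>m m - map_mat rf_const M"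
  have N: "?N \<in> carrier_mat m m" using M by (intro minus_carrier_mat) simp
  obtain E where E: "mat_inverse ?N = Some E" "E \<in> carrier_mat m m" "?N * E = 1\<^sub>m m"
    using mat_inverse_Some[OF N] nz unfolding phi_conv_det[OF M] by blast
  have "coronal M y = vec m (\<lambda>_. 1) \<bullet> (E *\<^sub>v vec m (\<lambda>_. 1))"
    using M E(1) by (auto simp: coronal_def Let_def)
  moreover have "mat 1 m (\<lambda>_. 1) * (E * mat m 1 (\<lambda>_. 1)) =
      mat 1 1 (\<lambda>_. vec m (\<lambda>_. 1) \<bullet> (E *\<^sub>v vec m (\<lambda>_. 1)))"
    using E(2) by (intro eq_matI) (auto simp: scalar_prod_def intro!: sum.cong)
  ultimately show ?thesis
    using that[OF E(2,3)] E(2) by (simp add: assoc_mult_mat[of _ 1 m _ m _ 1])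
qed

text \<open>A base vertex has degree \<open>r + m * r\<close>: the first summand is absorbed in
  \<open>K\<close>, the second shifts \<open>x\<close>. A copy vertex has degree \<open>r\<close>
  plus its degree in \<open>H\<close>, which shifts \<open>x\<close> by \<open>r\<close> in the last
  block.\<close>

lemma char_mat_corona:
  fixes vs :: "'a list" and us :: "'b list"
  assumes G: "pair_graph G" and reg: "regular_graph r G" and H: "pair_graph H"
    and vs: "vertex_enumeration vs G" and us: "vertex_enumeration us H"
  defines "n \<equiv> length vs" and "m \<equiv> length us"
  defines "K \<equiv> map_mat rf_const (laplacian_matrix vs G)"
  defines "A \<equiv> rf_const (real r) \<cdot>\<^sub>m 1\<^sub>m n - K"
  shows "x \<cdot>\<^sub>m 1\<^sub>m (n + n * m) - map_mat rf_const (laplacian_matrix (corona_enumeration vs us) (G \<star> H)) =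
    four_block_mat ((x - rf_const (real m * real r)) \<cdot>\<^sub>m 1\<^sub>m n - K)
      (kronecker A (mat 1 m (\<lambda>_. 1))) (kronecker A (mat m 1 (\<lambda>_. 1)))
      (kronecker (1\<^sub>m n) ((x - rf_const (real r)) \<cdot>\<^sub>m 1\<^sub>m m - map_mat rf_const (laplacian_matrix us H)))"
    (is "?L = four_block_mat ?P ?Q ?R ?S")
proof (rule eq_matI)
  let ?ws = "corona_enumeration vs us"
  note v = vertex_enumerationD[OF vs] and u = vertex_enumerationD[OF us]
  have len: "length ?ws = n + n * m" by (simp add: corona_enumeration_def n_def m_def)
  have LG: "laplacian_matrix vs G \<in> carrier_mat n n" and LH: "laplacian_matrix us H \<in> carrier_mat m m"
    by (simp_all add: n_def m_def)
  have LW: "laplacian_matrix ?ws (G \<star> H) \<in> carrier_mat (n + n * m) (n + n * m)"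
    using laplacian_matrix_carrier[of ?ws "G \<star> H"] by (simp only: len)
  have K: "K \<in> carrier_mat n n" using LG by (simp add: K_def)
  have A: "A \<in> carrier_mat n n" using K by (auto simp: A_def intro!: minus_carrier_mat)
  have N: "(x - rf_const (real r)) \<cdot>\<^sub>m 1\<^sub>m m - map_mat rf_const (laplacian_matrix us H) \<in> carrier_mat m m"
    using LH by (intro minus_carrier_mat) simp
  have P: "?P \<in> carrier_mat n n" using K by (intro minus_carrier_mat) simp
  have Q: "?Q \<in> carrier_mat n (n * m)" and R: "?R \<in> carrier_mat (n * m) n"
    and S: "?S \<in> carrier_mat (n * m) (n * m)"
    using kronecker_carrier[OF A, of "mat 1 m (\<lambda>_. 1)" 1 m] kronecker_carrier[OF A, of "mat m 1 (\<lambda>_. 1)" m 1]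
      kronecker_carrier[OF one_carrier_mat N, of n] by auto
  have L: "?L \<in> carrier_mat (n + n * m) (n + n * m)"
    using LW by (intro minus_carrier_mat) simp
  note F = four_block_carrier_mat[OF P S]
  show "dim_row ?L = dim_row (four_block_mat ?P ?Q ?R ?S)" "dim_col ?L = dim_col (four_block_mat ?P ?Q ?R ?S)"
    by (simp_all only: carrier_matD[OF L] carrier_matD[OF F])
  have vG: "vs ! i \<in> pverts G" if "i < n" for i
    using nth_mem[of i vs] that unfolding n_def v(2) .
  have uH: "us ! i \<in> pverts H" if "i < m" for i
    using nth_mem[of i us] that unfolding m_def u(2) .
  have deg: "out_degree (with_proj G) (vs ! i) = r" if "i < n" for i
    using reg vG[OF that] by (auto simp: regular_graph_def)
  have noloop: "(w, w) \<notin> parcs G" "(w', w') \<notin> parcs H" for w w'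
    using pair_graph_no_loop[OF G] pair_graph_no_loop[OF H] by blast+
  \<comment> \<open>Regularity cancels the diagonal of the Laplacian against \<open>r\<close>,
    leaving the adjacency matrix.\<close>
  have Aidx: "A $$ (i, j) = (if (vs ! i, vs ! j) \<in> parcs G then 1 else 0)" if "i < n" "j < n" for i j
    using that LG by (auto simp: A_def K_def index_laplacian_matrix deg noloop rf_const.hom_uminus simp flip: n_def)
  have lt: "k div m < n" "k mod m < m" if "k < n * m" for k
    using that less_mult_imp_div_less mod_less_of_less_mult by auto
  have ws1: "?ws ! i = Inl (vs ! i)" if "i < n" for i
    using that by (simp add: corona_enumeration_def nth_append n_def)
  have ws2: "?ws ! i = Inr (vs ! ((i - n) div m), us ! ((i - n) mod m))"
    if "\<not> i < n" "i < n + n * m" for i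
  proof -
    have "i - n < n * m" using that by linarith
    thus ?thesis using that by (simp add: corona_enumeration_def nth_append n_def m_def)
  qed
  have arcs [simp]:
    "(Inl a, Inl b) \<in> parcs (G \<star> H) \<longleftrightarrow> (a, b) \<in> parcs G"
    "(Inl a, Inr (b, c)) \<in> parcs (G \<star> H) \<longleftrightarrow> (b, a) \<in> parcs G \<and> c \<in> pverts H"
    "(Inr (b, c), Inl a) \<in> parcs (G \<star> H) \<longleftrightarrow> (b, a) \<in> parcs G \<and> c \<in> pverts H"
    "(Inr (b, c), Inr (b', c')) \<in> parcs (G \<star> H) \<longleftrightarrow> b = b' \<and> b \<in> pverts G \<and> (c, c') \<in> parcs H"
    for a b b' c c' by (auto simp: neighbourhood_corona_def)
  have vinj: "vs ! i = vs ! j \<longleftrightarrow> i = j" if "i < n" "j < n" for i j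
    using that v(1) by (simp add: n_def nth_eq_iff_index_eq)
  fix i j assume "i < dim_row (four_block_mat ?P ?Q ?R ?S)" "j < dim_col (four_block_mat ?P ?Q ?R ?S)"
  hence ij: "i < n + n * m" "j < n + n * m"
    by (simp_all only: carrier_matD[OF F])
  have lhs: "?L $$ (i, j) = (if i = j then x else 0) - rf_const (laplacian_matrix ?ws (G \<star> H) $$ (i, j))"
    using ij LW by simp
  have lap: "laplacian_matrix ?ws (G \<star> H) $$ (i, j) =
      (if i = j then real (out_degree (with_proj (G \<star> H)) (?ws ! i)) else 0)
      - (if (?ws ! i, ?ws ! j) \<in> parcs (G \<star> H) then 1 else 0)"
    using ij by (intro index_laplacian_matrix) (simp_all add: len)
  have rhs: "four_block_mat ?P ?Q ?R ?S $$ (i, j) =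
      (if i < n then if j < n then ?P $$ (i, j) else ?Q $$ (i, j - n)
       else if j < n then ?R $$ (i - n, j) else ?S $$ (i - n, j - n))"
    using ij by (subst index_mat_four_block) (simp_all only: carrier_matD[OF P] carrier_matD[OF S])
  consider "i < n" "j < n" | "i < n" "\<not> j < n" | "\<not> i < n" "j < n" | "\<not> i < n" "\<not> j < n" by blast
  thus "?L $$ (i, j) = four_block_mat ?P ?Q ?R ?S $$ (i, j)"
  proof cases
    case 1
    have "card (pverts H) = m" using u(3) by (simp add: m_def)
    thus ?thesis
      unfolding lhs rhs lap using 1 LG
      by (simp add: ws1 K_def out_degree_corona_Inl[OF G H] deg index_laplacian_matrix algebra_simps
          rf_const.hom_add rf_const.hom_minus flip: n_def)
  next
    case 2
    hence j: "j - n < n * m" using ij by auto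
    have "?Q $$ (i, j - n) = A $$ (i, (j - n) div m)"
      using 2 j lt[OF j] by (subst index_kronecker[OF A, of _ 1 m]) auto
    \<comment> \<open>The corona records this arc through \<open>(b, a)\<close> while
      \<open>A\<close> is read at \<open>(a, b)\<close>, so the symmetry of \<open>G\<close>
      enters.\<close>
    thus ?thesis
      unfolding lhs rhs lap using 2 ij lt[OF j] uH
      by (auto simp: ws1 ws2 Aidx rf_const.hom_uminus pair_graph_arc_sym[OF G, of "vs ! i"])
  next
    case 3
    hence i: "i - n < n * m" using ij by auto
    have "?R $$ (i - n, j) = A $$ ((i - n) div m, j)"
      using 3 i lt[OF i] by (subst index_kronecker[OF A, of _ m 1]) auto
    thus ?thesis
      unfolding lhs rhs lap using 3 ij lt[OF i] uH
      by (auto simp: ws1 ws2 Aidx rf_const.hom_uminus)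
  next
    case 4
    \<comment> \<open>Offsets past the base vertices: the quotient by \<open>m\<close> names the
      copy, the remainder the vertex in it.\<close>
    define k l where "k = i - n" and "l = j - n"
    have kl: "k < n * m" "l < n * m" using 4 ij by (auto simp: k_def l_def)
    have eq: "i = j \<longleftrightarrow> k = l" using 4 by (auto simp: k_def l_def)
    have eq': "k = l \<longleftrightarrow> k div m = l div m \<and> k mod m = l mod m"
      by (metis div_mult_mod_eq)
    have ws: "?ws ! i = Inr (vs ! (k div m), us ! (k mod m))" "?ws ! j = Inr (vs ! (l div m), us ! (l mod m))"
      using 4 ij ws2 by (auto simp: k_def l_def)
    note lts = lt[OF kl(1)] lt[OF kl(2)]
    have Sidx: "?S $$ (k, l) = (if k div m = l div m then
        (if k mod m = l mod m then x - rf_const (real r) else 0)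
        - rf_const (laplacian_matrix us H $$ (k mod m, l mod m)) else 0)"
      using kl lts LH by (subst index_kronecker[OF one_carrier_mat N]) auto
    have lapH: "laplacian_matrix us H $$ (k mod m, l mod m) =
        (if k mod m = l mod m then real (out_degree (with_proj H) (us ! (k mod m))) else 0)
        - (if (us ! (k mod m), us ! (l mod m)) \<in> parcs H then 1 else 0)"
      using lts by (intro index_laplacian_matrix) (simp_all add: m_def)
    have "four_block_mat ?P ?Q ?R ?S $$ (i, j) = ?S $$ (k, l)"
      unfolding rhs using 4 by (simp add: k_def l_def)
    thus ?thesis
      unfolding lhs lap Sidx lapH ws using lts
      by (auto simp: eq eq' out_degree_corona_Inr[OF G H vG uH] deg vinj vG noloop
          rf_const.hom_add rf_const.hom_minus rf_const.hom_uminus)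
  qed
qed

theorem theorem2p9:
  fixes G\<^sub>1 :: "'a pair_pre_digraph" and G\<^sub>2 :: "'b pair_pre_digraph"
    and n\<^sub>1 n\<^sub>2 r\<^sub>1 :: nat
    and vs :: "'a list" and us :: "'b list" and ws :: "('a + 'a \<times> 'b) list"
  assumes "pair_graph G\<^sub>1" and "regular_graph r\<^sub>1 G\<^sub>1" and "card (pverts G\<^sub>1) = n\<^sub>1"
    and "pair_graph G\<^sub>2" and "card (pverts G\<^sub>2) = n\<^sub>2"
    and "n\<^sub>1 \<ge> 2" and "n\<^sub>2 \<ge> 1" and "r\<^sub>1 \<ge> 1"
    and "vertex_enumeration vs G\<^sub>1"
    and "vertex_enumeration us G\<^sub>2"
    and "vertex_enumeration ws (G\<^sub>1 \<star> G\<^sub>2)"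
  shows "phi (laplacian_matrix ws (G\<^sub>1 \<star> G\<^sub>2)) rf_X =
    phi (laplacian_matrix us G\<^sub>2) (rf_X - rf_const (real r\<^sub>1)) ^ n\<^sub>1 *
    (\<Prod>i<n\<^sub>1. let \<mu> = real_eigenvalues (laplacian_matrix vs G\<^sub>1) ! i in
       rf_X - rf_const (real n\<^sub>2 * real r\<^sub>1) - rf_const \<mu>
       - coronal (laplacian_matrix us G\<^sub>2) (rf_X - rf_const (real r\<^sub>1))
         * (rf_const (real r\<^sub>1) - rf_const \<mu>)^2)"
proof -
  let ?LG = "laplacian_matrix vs G\<^sub>1" and ?LH = "laplacian_matrix us G\<^sub>2"
  let ?x' = "rf_X - rf_const (real r\<^sub>1)"
  let ?c = "rf_X - rf_const (real n\<^sub>2 * real r\<^sub>1)"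
  let ?row = "mat 1 n\<^sub>2 (\<lambda>_. 1) :: ratfun mat" and ?col = "mat n\<^sub>2 1 (\<lambda>_. 1) :: ratfun mat"
  note G = assms(1) and H = assms(4) and vs = assms(9) and us = assms(10) and ws = assms(11)
  have n: "length vs = n\<^sub>1" "length us = n\<^sub>2"
    using vertex_enumerationD(3)[OF vs] vertex_enumerationD(3)[OF us] assms(3,5) by auto
  have LG: "?LG \<in> carrier_mat n\<^sub>1 n\<^sub>1" and LH: "?LH \<in> carrier_mat n\<^sub>2 n\<^sub>2"
    using laplacian_matrix_carrier[of vs G\<^sub>1] laplacian_matrix_carrier[of us G\<^sub>2] by (simp_all only: n)
  define g where "g = coronal ?LH ?x'"
  define N where "N = ?x' \<cdot>\<^sub>m 1\<^sub>m n\<^sub>2 - map_mat rf_const ?LH"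
  define K where "K = map_mat rf_const ?LG"
  define A where "A = rf_const (real r\<^sub>1) \<cdot>\<^sub>m 1\<^sub>m n\<^sub>1 - K"
  define P where "P = ?c \<cdot>\<^sub>m 1\<^sub>m n\<^sub>1 - K"
  obtain E where E: "E \<in> carrier_mat n\<^sub>2 n\<^sub>2" and NE: "N * E = 1\<^sub>m n\<^sub>2"
    and gE: "?row * E * ?col = mat 1 1 (\<lambda>_. g)"
    using coronal_inverse[OF LH phi_shift_nonzero[OF LH]] unfolding N_def g_def by blast
  have N: "N \<in> carrier_mat n\<^sub>2 n\<^sub>2" and K: "K \<in> carrier_mat n\<^sub>1 n\<^sub>1"
    using LG LH by (auto simp: N_def K_def intro!: minus_carrier_mat)
  have A: "A \<in> carrier_mat n\<^sub>1 n\<^sub>1" and P: "P \<in> carrier_mat n\<^sub>1 n\<^sub>1"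
    using K by (auto simp: A_def P_def intro!: minus_carrier_mat)
  have row: "?row \<in> carrier_mat 1 n\<^sub>2" and col: "?col \<in> carrier_mat n\<^sub>2 1" by auto
  let ?I = "1\<^sub>m n\<^sub>1 :: ratfun mat"
  have I: "?I \<in> carrier_mat n\<^sub>1 n\<^sub>1" by simp
  have kr: "kronecker A ?row \<in> carrier_mat n\<^sub>1 (n\<^sub>1 * n\<^sub>2)"
    and kc: "kronecker A ?col \<in> carrier_mat (n\<^sub>1 * n\<^sub>2) n\<^sub>1"
    using kronecker_carrier[OF A row] kronecker_carrier[OF A col] by simp_all
  have inv: "kronecker ?I N * kronecker ?I E = 1\<^sub>m (n\<^sub>1 * n\<^sub>2)"
    unfolding kronecker_mult[OF I N I E] NE by (simp add: kronecker_one)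
  \<comment> \<open>Two uses of the mixed-product rule separate the factors: \<open>A\<close>,
    \<open>?I\<close>, \<open>A\<close> multiply to the square of \<open>A\<close>, and
    \<open>?row\<close>, \<open>E\<close>, \<open>?col\<close> to the coronal.\<close>
  have "kronecker A ?row * kronecker ?I E * kronecker A ?col = kronecker (A * A) (mat 1 1 (\<lambda>_. g))"
    unfolding gE[symmetric] kronecker_mult[OF A row I E] right_mult_one_mat[OF A]
    by (rule kronecker_mult[OF A mult_carrier_mat[OF row E] A col])
  also have "\<dots> = g \<cdot>\<^sub>m (A * A)"
    using A by (intro eq_matI) (auto simp: kronecker_def simp del: index_mult_mat(1))
  finally have core: "kronecker A ?row * kronecker ?I E * kronecker A ?col = g \<cdot>\<^sub>m (A * A)" .
  let ?W = "laplacian_matrix (corona_enumeration vs us) (G\<^sub>1 \<star> G\<^sub>2)"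
  have W: "?W \<in> carrier_mat (n\<^sub>1 + n\<^sub>1 * n\<^sub>2) (n\<^sub>1 + n\<^sub>1 * n\<^sub>2)"
    using laplacian_matrix_carrier[of "corona_enumeration vs us" "G\<^sub>1 \<star> G\<^sub>2"]
    by (simp add: corona_enumeration_def n)
  have "phi (laplacian_matrix ws (G\<^sub>1 \<star> G\<^sub>2)) rf_X = phi ?W rf_X"
    by (rule phi_laplacian_enumeration_cong[OF ws vertex_enumeration_corona[OF vs us]])
  also have "\<dots> = det (four_block_mat P (kronecker A ?row) (kronecker A ?col) (kronecker ?I N))"
    unfolding phi_conv_det[OF W] P_def A_def K_def N_def
    using char_mat_corona[OF G assms(2) H vs us, of rf_X] by (simp add: n)
  also have "\<dots> = det (kronecker ?I N) * det (P - g \<cdot>\<^sub>m (A * A))"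
    unfolding core[symmetric]
    by (rule det_schur_complement[OF P kr kc kronecker_carrier[OF I N] kronecker_carrier[OF I E] inv])
  also have "det (kronecker ?I N) = phi ?LH ?x' ^ n\<^sub>1"
    unfolding det_kronecker_one[OF N] by (simp add: N_def phi_conv_det[OF LH])
  also have "det (P - g \<cdot>\<^sub>m (A * A)) =
      (\<Prod>i<n\<^sub>1. ?c - rf_const (real_eigenvalues ?LG ! i)
        - g * (rf_const (real r\<^sub>1) - rf_const (real_eigenvalues ?LG ! i))\<^sup>2)"
    unfolding P_def A_def K_def by (rule det_quadratic_symmetric[OF LG laplacian_matrix_sym[OF G]])
  finally show ?thesis unfolding Let_def g_def .
qed

end
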